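(* For arbitrary integers $m\geq 2$, $n\geq m+1$, $d\geq 1$ there exists an integral point set $M$ of $n$ points in $\mathbb{R}^m$ containing two points $M_1,M_2$ with $|M_1M_2|=d$.
   Context: An integral point set in $\mathbb{R}^m$ is a finite set $M\subset\mathbb{R}^m$ such that all pairwise Euclidean distances between points of $M$ are integers and $M$ is not contained in any $(m-1)$-dimensional affine hyperplane. *)

theory Defs
  imports "HOL-Analysis.Analysis"
begin

definition integral_point_set :: "(real ^ 'm) set \<Rightarrow> bool" where
  "integral_point_set M \<longleftrightarrow>
     finite M \<and>
     (\<forall>x\<in>M. \<forall>y\<in>M. dist x y \<in> \<int>) \<and>
     \<not> (\<exists>H :: (real ^ 'm) set. affine H \<and> aff_dim H = int CARD('m) - 1 \<and> M \<subseteq> H)"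

end

theory Submission
  imports Defs
begin

text \<open>
  By scaling it suffices to treat \<open>d = 1\<close>. Put \<open>n - m + 1\<close> points on a line through the origin and
  the remaining \<open>m - 1\<close> points at the vertices of a regular simplex of edge \<open>1\<close> in the orthogonal
  complement of that line, all at distance \<open>sqrt D / 2\<close> from the origin. A point at position \<open>p\<close> on
  the line is at distance \<open>q\<close> from every vertex iff \<open>(2q - 2p) (2q + 2p) = D\<close>, so a number
  \<open>D = 5^K (5^K + 2)\<close> with many factorisations \<open>5^(K-i) * (5^i (5^K + 2))\<close> provides many admissible
  positions. The factorisation \<open>i = 0\<close> gives \<open>p = 1/2\<close>, and \<open>-1/2\<close> is admissible as well.
\<close>

text \<open>An affine set of dimension \<open>CARD('m) - 1\<close> is a hyperplane
  \<open>w \<bullet> x = b\<close> with \<open>w \<noteq> 0\<close>. Non-degeneracy thus becomes a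
  condition on normals, which is easy to check in coordinates and to carry through a
  scaling.\<close>

lemma integral_point_setI:
  fixes M :: "(real ^ 'm) set"
  assumes "finite M"
    and "\<And>x y. x \<in> M \<Longrightarrow> y \<in> M \<Longrightarrow> dist x y \<in> \<int>"
    and full: "\<And>w b. (\<And>x. x \<in> M \<Longrightarrow> w \<bullet> x = b) \<Longrightarrow> w = 0"
  shows "integral_point_set M"
proof -
  have False if H: "affine H" "aff_dim H = int CARD('m) - 1" "M \<subseteq> H" for H :: "(real ^ 'm) set"
  proof -
    obtain w b where "w \<noteq> 0" "affine hull H = {x. w \<bullet> x = b}"
      using H(2) aff_dim_eq_hyperplane[of H] by auto
    moreover have "affine hull H = H"
      using H(1) by (simp add: hull_same)
    ultimately have "w \<bullet> x = b" if "x \<in> M" for x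
      using H(3) that by blast
    with full \<open>w \<noteq> 0\<close> show False
      by blast
  qed
  with assms(1,2) show ?thesis
    unfolding integral_point_set_def by blast
qed

text \<open>Multiplying by \<open>c\<close> and completing the square gives
  \<open>(s + c * t)\<^sup>2 = s\<^sup>2 + c * (r - s\<^sup>2)\<close>; the positive square root
  makes \<open>t\<close> nonnegative. This \<open>t\<close> will tune the circumradius of the
  simplex.\<close>

lemma quadratic_nonneg_root:
  fixes c s r :: real
  assumes "c > 0" "r \<ge> s\<^sup>2" "s \<ge> 0"
  obtains t where "t \<ge> 0" "s\<^sup>2 + 2 * s * t + c * t\<^sup>2 = r"
proof -
  define q where "q = sqrt (s\<^sup>2 + c * (r - s\<^sup>2))"
  have nonneg: "c * (r - s\<^sup>2) \<ge> 0"
    using assms by simp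
  have q2: "q\<^sup>2 = s\<^sup>2 + c * (r - s\<^sup>2)"
    unfolding q_def using nonneg by simp
  have "q \<ge> s"
    unfolding q_def using nonneg assms(3) by (intro real_le_rsqrt) simp
  define t where "t = (q - s) / c"
  have ct: "c * t = q - s"
    using assms(1) by (simp add: t_def)
  have "c * (s\<^sup>2 + 2 * s * t + c * t\<^sup>2) = c * s\<^sup>2 + 2 * s * (c * t) + (c * t)\<^sup>2"
    by (simp add: algebra_simps power2_eq_square)
  also have "\<dots> = c * r"
    unfolding ct using q2 by (simp add: algebra_simps power2_eq_square)
  finally have "s\<^sup>2 + 2 * s * t + c * t\<^sup>2 = r"
    using assms(1) by simp
  moreover have "t \<ge> 0"
    using \<open>q \<ge> s\<close> assms(1) by (simp add: t_def)
  ultimately show thesis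
    using that by blast
qed

text \<open>The basis vectors other than the one at \<open>k\<close>, scaled by
  \<open>sqrt (1/2)\<close>, have mutual distance 1. A common shift along their sum \<open>U\<close>
  preserves these distances and raises the squared norm from 1/2 to any larger
  \<open>r\<close>.\<close>

lemma unit_simplex_in_orthogonal_complement:
  fixes k :: "'m::finite" and r :: real
  assumes "CARD('m) \<ge> 2" "r \<ge> 1/2"
  obtains a :: "'m \<Rightarrow> real ^ 'm" where
    "\<forall>j. j \<noteq> k \<longrightarrow> a j $ k = 0 \<and> (norm (a j))\<^sup>2 = r"
    "\<forall>i j. i \<noteq> j \<longrightarrow> dist (a i) (a j) = 1"
    "\<forall>w. w $ k = 0 \<and> (\<forall>j. j \<noteq> k \<longrightarrow> w \<bullet> a j = 0) \<longrightarrow> w = 0"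
proof -
  define J where "J = UNIV - {k}"
  define c where "c = real (card J)"
  have c: "c > 0"
    using assms(1) by (simp add: c_def J_def card_Diff_singleton)
  define s where "s = sqrt (1/2)"
  have s: "s > 0" "s\<^sup>2 = 1/2"
    by (simp_all add: s_def)
  obtain t where t: "t \<ge> 0" "s\<^sup>2 + 2 * s * t + c * t\<^sup>2 = r"
    using quadratic_nonneg_root[of c s r] c s assms(2) by auto
  define U :: "real ^ 'm" where "U = (\<Sum>j\<in>J. axis j 1)"
  define a where "a j = s *\<^sub>R axis j 1 + t *\<^sub>R U" for j
  have wU: "w \<bullet> U = (\<Sum>j\<in>J. w $ j)" for w
    by (simp add: U_def inner_sum_right inner_axis)
  have Unth: "U $ i = (if i = k then 0 else 1)" for i
    by (simp add: U_def J_def axis_def sum.delta)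
  have UU: "U \<bullet> U = c"
    by (simp add: wU Unth c_def J_def)
  have wa: "w \<bullet> a j = s * w $ j + t * (\<Sum>j\<in>J. w $ j)" for w j
    by (simp add: a_def inner_add_right inner_axis wU)
  show thesis
  proof (rule that; intro allI impI)
    show "a j $ k = 0 \<and> (norm (a j))\<^sup>2 = r" if "j \<noteq> k" for j
    proof -
      have "a j $ k = 0"
        using that by (simp add: a_def Unth axis_def)
      moreover have "(norm (a j))\<^sup>2 = s\<^sup>2 + 2 * s * t + c * t\<^sup>2"
        using that unfolding a_def power2_norm_eq_inner
        by (simp add: inner_add_left inner_add_right inner_axis inner_axis' UU Unth
            algebra_simps power2_eq_square)
      ultimately show ?thesis
        using t by simp
    qed
    show "dist (a i) (a j) = 1" if "i \<noteq> j" for i j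
    proof -
      have "a i - a j = s *\<^sub>R (axis i 1 - axis j 1)"
        by (simp add: a_def algebra_simps)
      then have "(dist (a i) (a j))\<^sup>2 = s\<^sup>2 * (norm (axis i 1 - axis j 1 :: real ^ 'm))\<^sup>2"
        by (simp add: dist_norm power_mult_distrib)
      also have "(norm (axis i 1 - axis j 1 :: real ^ 'm))\<^sup>2 = 2"
        using that unfolding power2_norm_eq_inner
        by (simp add: inner_diff_left inner_diff_right inner_axis_axis)
      finally show ?thesis
        using s by (simp add: power2_eq_1_iff) (smt (verit) zero_le_dist)
    qed
    show "w = 0" if w: "w $ k = 0 \<and> (\<forall>j. j \<noteq> k \<longrightarrow> w \<bullet> a j = 0)" for w
    proof -
      define W where "W = (\<Sum>j\<in>J. w $ j)"
      have eq: "s * w $ j + t * W = 0" if "j \<in> J" for j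
        using w that wa[of w j] by (simp add: J_def W_def)
      \<comment> \<open>Summing the orthogonality relations isolates \<open>W\<close>. Its factor is
        positive because \<open>t\<close> was chosen nonnegative; once \<open>W\<close> vanishes,
        each coordinate does.\<close>
      have "(s + c * t) * W = (\<Sum>j\<in>J. s * w $ j + t * W)"
        by (simp add: sum.distrib c_def algebra_simps flip: sum_distrib_left W_def)
      also have "\<dots> = 0"
        using eq by simp
      finally have "W = 0"
        using s(1) t(1) c by (smt (verit) mult_eq_0_iff mult_nonneg_nonneg)
      have "w $ i = 0" for i
      proof (cases "i = k")
        case False
        with eq[of i] \<open>W = 0\<close> s(1) show ?thesis
          by (simp add: J_def)
      qed (simp add: w)
      then show "w = 0"
        by (simp add: vec_eq_iff)
    qed
  qed
qed

text \<open>If \<open>u * v = 4 * r\<close>, then \<open>p = (v - u) / 4\<close> and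
  \<open>q = (v + u) / 4\<close> satisfy \<open>p\<^sup>2 + r = q\<^sup>2\<close>. With
  \<open>u\<close> congruent to 1 and \<open>v\<close> to 3 modulo 4, \<open>q\<close> is an integer
  and \<open>p\<close> lies in 1/2 plus the integers, so differences of positions are
  integers.\<close>

lemma half_integer_positions:
  obtains r :: real and P :: "real set" where
    "r \<ge> 1/2" "finite P" "card P = K + 2" "1/2 \<in> P" "-1/2 \<in> P" "0 \<notin> P"
    "\<forall>p\<in>P. \<forall>q\<in>P. p - q \<in> \<int>" "\<forall>p\<in>P. sqrt (p\<^sup>2 + r) \<in> \<int>"
proof -
  \<comment> \<open>The summand 2 makes \<open>v 0 - u 0 = 2\<close>, hence
    \<open>p 0 = 1/2\<close>, and gives \<open>B\<close> the residue 3, while powers of 5 have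
    residue 1.\<close>
  define B :: int where "B = 5 ^ K + 2"
  define u v :: "nat \<Rightarrow> int" where "u i = 5 ^ (K - i)" and "v i = 5 ^ i * B" for i
  define p where "p i = real_of_int (v i - u i) / 4" for i
  define r where "r = real_of_int (5 ^ K * B) / 4"
  \<comment> \<open>The extra position is \<open>- p 0\<close>: only the square of a position enters
    its distance to the simplex.\<close>
  define P where "P = insert (-1/2) (p ` {..K})"
  have pow5: "(5::int) ^ i mod 4 = 1" for i
    by (subst power_mod[symmetric]) simp
  have u_mod: "u i mod 4 = 1" for i
    by (simp add: u_def pow5)
  have "B mod 4 = 3"
    unfolding B_def by (subst mod_add_left_eq[symmetric]) (simp add: pow5)
  then have v_mod: "v i mod 4 = 3" for i
    unfolding v_def by (subst mod_mult_eq[symmetric]) (simp add: pow5)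
  have diff_mod: "4 dvd v i - u i - 2" and sum_dvd: "4 dvd v i + u i" for i
    using u_mod[of i] v_mod[of i] by presburger+
  have p_diff: "\<exists>z::int. p i = 1/2 + z" for i
  proof -
    obtain z where "v i - u i - 2 = 4 * z"
      using diff_mod[of i] by (elim dvdE)
    then have "v i - u i = 4 * z + 2" by simp
    then show ?thesis
      by (intro exI[of _ z]) (simp add: p_def)
  qed
  have strict: "p i < p j" if "i < j" for i j
  proof -
    have "u j \<le> u i"
      using that by (simp add: u_def power_increasing)
    moreover have "v i < v j"
      using that by (simp add: v_def B_def power_strict_increasing add_pos_pos)
    ultimately show ?thesis
      by (simp add: p_def flip: of_int_diff)
  qed
  have p0: "p 0 = 1/2"
    by (simp add: p_def u_def v_def B_def)
  have p_pos: "p i > 0" for i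
    using strict[of 0 i] p0 by (cases "i = 0") auto
  have "inj_on p {..K}"
    by (rule inj_onI) (metis strict less_irrefl linorder_neqE_nat)
  then have card: "card P = K + 2"
    using p_pos unfolding P_def
    by (subst card_insert_disjoint) (auto simp: card_image, smt (verit) divide_nonneg_nonneg)
  have half: "\<exists>z::int. q = 1/2 + z" if "q \<in> P" for q
    using that p_diff unfolding P_def by (auto intro: exI[of _ "-1"])
  have p_sqrt: "sqrt ((p i)\<^sup>2 + r) \<in> \<int>" if "i \<le> K" for i
  proof -
    \<comment> \<open>Only here is \<open>i \<le> K\<close> needed: beyond \<open>K\<close> the
      truncated subtraction freezes \<open>u i\<close> at 1.\<close>
    have "u i * v i = 5 ^ K * B"
      using that by (simp add: u_def v_def flip: power_add mult.assoc)
    then have r: "r = real_of_int (u i) * real_of_int (v i) / 4"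
      unfolding r_def by (simp flip: of_int_mult)
    obtain z where z: "v i + u i = 4 * z"
      using sum_dvd[of i] by (elim dvdE)
    have "u i \<ge> 0" "v i \<ge> 0"
      by (simp_all add: u_def v_def B_def)
    with z have "z \<ge> 0" by simp
    have z': "real_of_int (v i) = 4 * real_of_int z - real_of_int (u i)"
      using z by linarith
    have "(p i)\<^sup>2 + r = (real_of_int z)\<^sup>2"
      unfolding r p_def of_int_diff z' by (simp add: field_simps power2_eq_square)
    with \<open>z \<ge> 0\<close> show ?thesis by simp
  qed
  show thesis
  proof (rule that; (intro ballI)?)
    have "(5::int) ^ K \<ge> 1" by simp
    then have "5 ^ K * B \<ge> 1 * 3"
      unfolding B_def by (intro mult_mono) auto
    then have "real_of_int (5 ^ K * B) \<ge> 3"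
      by linarith
    then show "r \<ge> 1/2"
      by (simp add: r_def)
    show "finite P" "-1/2 \<in> P"
      by (simp_all add: P_def)
    show "card P = K + 2" by (rule card)
    show "1/2 \<in> P"
      using p0 unfolding P_def by (metis atMost_iff image_eqI insertCI le0)
    show "0 \<notin> P"
      using p_pos unfolding P_def by (auto simp: less_le)
    show "q - q' \<in> \<int>" if "q \<in> P" "q' \<in> P" for q q'
      using half[OF that(1)] half[OF that(2)] by auto
    show "sqrt (q\<^sup>2 + r) \<in> \<int>" if "q \<in> P" for q
      using that p_sqrt p_sqrt[of 0] unfolding P_def by (auto simp: p0 power2_eq_square)
  qed
qed

text \<open>The line and the simplex lie in orthogonal subspaces, so mixed distances follow from
  Pythagoras. Non-degeneracy is kept in terms of normals, ready for the scaling by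
  \<open>d\<close>.\<close>

lemma integral_point_set_with_unit_distance:
  assumes "CARD('m::finite) \<ge> 2" "n \<ge> CARD('m) + 1"
  obtains M :: "(real ^ 'm) set" and x y where
    "finite M" "card M = n" "x \<in> M" "y \<in> M" "dist x y = 1"
    "\<And>x y. x \<in> M \<Longrightarrow> y \<in> M \<Longrightarrow> dist x y \<in> \<int>"
    "\<And>w b. (\<And>x. x \<in> M \<Longrightarrow> w \<bullet> x = b) \<Longrightarrow> w = 0"
proof -
  \<comment> \<open>The parameter is chosen so that the \<open>n - CARD('m) + 1\<close> positions
    and the \<open>CARD('m) - 1\<close> simplex vertices add up to \<open>n\<close>.\<close>
  obtain r :: real and P :: "real set" where
    r: "r \<ge> 1/2" and P: "finite P" "card P = (n - CARD('m) - 1) + 2"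
      "1/2 \<in> P" "-1/2 \<in> P" "0 \<notin> P"
    and P_diff: "\<forall>p\<in>P. \<forall>q\<in>P. p - q \<in> \<int>" and P_sqrt: "\<forall>p\<in>P. sqrt (p\<^sup>2 + r) \<in> \<int>"
    by (rule half_integer_positions[of "n - CARD('m) - 1"])
  define k :: 'm where "k = undefined"
  obtain a :: "'m \<Rightarrow> real ^ 'm" where
    a: "\<forall>j. j \<noteq> k \<longrightarrow> a j $ k = 0 \<and> (norm (a j))\<^sup>2 = r" and
    adist: "\<forall>i j. i \<noteq> j \<longrightarrow> dist (a i) (a j) = 1" and
    aspan: "\<forall>w. w $ k = 0 \<and> (\<forall>j. j \<noteq> k \<longrightarrow> w \<bullet> a j = 0) \<longrightarrow> w = 0"
    by (rule unit_simplex_in_orthogonal_complement[OF assms(1) r, of k])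
  define A where "A = a ` (UNIV - {k})"
  define L :: "(real ^ 'm) set" where "L = axis k ` P"
  have dist_LL: "dist (axis k p) (axis k q :: real ^ 'm) = \<bar>p - q\<bar>" for p q :: real
  proof -
    have "axis k p - axis k q = (axis k (p - q) :: real ^ 'm)"
      by (simp add: axis_def vec_eq_iff)
    then show ?thesis
      by (simp add: dist_norm norm_eq_sqrt_inner inner_axis_axis)
  qed
  have dist_LA: "dist (axis k p) (a j) = sqrt (p\<^sup>2 + r)" if "j \<noteq> k" for p j
  proof -
    have "(dist (axis k p) (a j))\<^sup>2 = p\<^sup>2 + r"
      using a that unfolding dist_norm power2_norm_eq_inner
      by (simp add: inner_diff_left inner_diff_right inner_axis inner_axis' power2_eq_square)
    then show ?thesis
      by (metis real_sqrt_unique zero_le_dist)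
  qed
  have "inj_on a (UNIV - {k})"
    by (rule inj_onI) (metis adist dist_self zero_neq_one)
  then have "card A = CARD('m) - 1"
    by (simp add: A_def card_image card_Diff_singleton)
  moreover have "card L = card P"
    unfolding L_def by (intro card_image inj_onI) (auto simp: axis_eq_axis)
  moreover have "A \<inter> L = {}"
  proof -
    \<comment> \<open>The \<open>k\<close>-th coordinate is 0 on the left and a nonzero position on
      the right.\<close>
    have "a j \<noteq> axis k p" if "j \<noteq> k" "p \<in> P" for j p
      using a that P(5) by (metis axis_nth)
    then show ?thesis
      by (auto simp: A_def L_def)
  qed
  moreover have fin: "finite A" "finite L"
    using P(1) by (simp_all add: A_def L_def)
  ultimately have card: "card (A \<union> L) = n"
    using P(2) assms by (simp add: card_Un_disjoint)
  show thesis
  proof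
    show "finite (A \<union> L)" "card (A \<union> L) = n"
      using fin card by simp_all
    show "axis k (1/2) \<in> A \<union> L" "axis k (-1/2) \<in> A \<union> L"
      using P by (auto simp: L_def)
    show "dist (axis k (1/2)) (axis k (-1/2) :: real ^ 'm) = 1"
      unfolding dist_LL by simp
    have AA: "dist x y \<in> \<int>" if "x \<in> A" "y \<in> A" for x y
    proof -
      obtain i j where ij: "i \<noteq> k" "j \<noteq> k" "x = a i" "y = a j"
        using \<open>x \<in> A\<close> \<open>y \<in> A\<close> by (auto simp: A_def)
      then show ?thesis
        using adist by (cases "i = j") auto
    qed
    have LA: "dist x y \<in> \<int>" if "x \<in> L" "y \<in> A" for x y
    proof -
      obtain p j where pj: "p \<in> P" "j \<noteq> k" "x = axis k p" "y = a j"
        using \<open>x \<in> L\<close> \<open>y \<in> A\<close> by (auto simp: A_def L_def)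
      then show ?thesis
        using P_sqrt by (simp add: dist_LA)
    qed
    have LL: "dist x y \<in> \<int>" if "x \<in> L" "y \<in> L" for x y
      using that P_diff by (auto simp: L_def dist_LL)
    show "dist x y \<in> \<int>" if "x \<in> A \<union> L" "y \<in> A \<union> L" for x y
      using that AA LL LA LA[of y x] by (auto simp: dist_commute)
    show "w = 0" if eq: "\<And>x. x \<in> A \<union> L \<Longrightarrow> w \<bullet> x = b" for w b
    proof (rule aspan[rule_format], intro conjI allI impI)
      \<comment> \<open>Two opposite points on the line force both \<open>w $ k\<close> and
        \<open>b\<close> to vanish, so the conditions at the simplex vertices become orthogonality
        to the \<open>a j\<close>.\<close>
      have "w \<bullet> axis k (1/2) = b" "w \<bullet> axis k (-1/2) = b"
        using P by (auto simp: L_def intro!: eq)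
      then have "w $ k = 0" "b = 0"
        by (simp_all add: inner_axis)
      then show "w $ k = 0" by blast
      show "w \<bullet> a j = 0" if "j \<noteq> k" for j
        using eq[of "a j"] that \<open>b = 0\<close> by (simp add: A_def)
    qed
  qed
qed

theorem theorem6:
  fixes n d :: nat
  assumes "CARD('m::finite) \<ge> 2"
    and "n \<ge> CARD('m) + 1"
    and "d \<ge> 1"
  shows "\<exists>M :: (real ^ 'm) set. integral_point_set M \<and> card M = n \<and>
           (\<exists>M\<^sub>1\<in>M. \<exists>M\<^sub>2\<in>M. dist M\<^sub>1 M\<^sub>2 = real d)"
proof -
  obtain M :: "(real ^ 'm) set" and x y where
    M: "finite M" "card M = n" "x \<in> M" "y \<in> M" "dist x y = 1" and
    int: "\<And>x y. x \<in> M \<Longrightarrow> y \<in> M \<Longrightarrow> dist x y \<in> \<int>" and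
    full: "\<And>w b. (\<And>x. x \<in> M \<Longrightarrow> w \<bullet> x = b) \<Longrightarrow> w = 0"
    by (rule integral_point_set_with_unit_distance[OF assms(1,2)]) (rule that; blast)
  let ?f = "\<lambda>x :: real ^ 'm. real d *\<^sub>R x"
  have dist_f: "dist (?f x) (?f y) = real d * dist x y" for x y
    unfolding dist_norm scaleR_diff_right[symmetric] norm_scaleR by simp
  have "integral_point_set (?f ` M)"
  proof (rule integral_point_setI)
    show "finite (?f ` M)"
      using M(1) by simp
    show "dist x y \<in> \<int>" if "x \<in> ?f ` M" "y \<in> ?f ` M" for x y
      using that int by (auto simp: dist_f)
    show "w = 0" if eq: "\<And>x. x \<in> ?f ` M \<Longrightarrow> w \<bullet> x = b" for w b
    \<comment> \<open>A hyperplane through the scaled set pulls back to one through \<open>M\<close>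
      with the same normal and offset \<open>b / d\<close>.\<close>
    proof (rule full)
      show "w \<bullet> x = b / d" if "x \<in> M" for x
        using eq[of "?f x"] that assms(3) by (simp add: field_simps)
    qed
  qed
  moreover have "card (?f ` M) = n"
    using M(2) assms(3) by (subst card_image) (auto intro!: inj_onI)
  moreover have "dist (?f x) (?f y) = real d"
    unfolding dist_f using M(5) by simp
  ultimately show ?thesis
    using M(3,4) by blast
qed

end
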